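(* Let $n\in\mathbb N$, let $P_{j_1},\dots,P_{j_n}$ be Legendre polynomials and $Q_{k_1},\dots,Q_{k_n}$ be Legendre functions of the second kind (indices in $\mathbb N_0$), and put $w_i=P_{j_i}$, $w_{n+i}=Q_{k_i}$ for $i=1,\dots,n$. Let $\mathbf M_n$ be the $(2n)\times(2n)$ matrix with entries $(\mathbf M_n)_{il}=[w_i,w_l]_n\big|_{-1}^1$. Suppose $\mathbf M_n$ has full rank, so that these functions define a basis (modulo $\mathcal D^n_{\min}$) of the space $\mathcal D^n_+\dotplus\mathcal D^n_-$. Let $\mathfrak I=\{j_1,\dots,j_n,k_1,\dots,k_n\}$ be the collection (counted with repetition) of the $2n$ indices of these functions. Then $\mathfrak I$ contains $n$ even and $n$ odd elements.
   Context: $\ell[y](x)=-((1-x^2)y'(x))'$ is the Legendre differential expression on $L^2(-1,1)$ and $\ell^n$ is its $n$-fold composition. $P_k$ is the Legendre polynomial of degree $k$, and $Q_k$, $k\in\mathbb N_0$, is the Legendre function of the second kind on $(-1,1)$: $Q_0(x)=\frac12\ln\frac{1+x}{1-x}$, $Q_1(x)=xQ_0(x)-1$, $(k+1)Q_{k+1}=(2k+1)xQ_k-kQ_{k-1}$. Both satisfy $\ell[y]=k(k+1)y$. $\mathcal D^n_{\max}=\{y:(-1,1)\to\mathbb C: y^{(k)}\in AC_{\rm loc}(-1,1),\ k=0,\dots,2n-1;\ y,\ell^n[y]\in L^2(-1,1)\}$; for $f,g\in\mathcal D^n_{\max}$, $[f,g]_n|_{-1}^1=\int_{-1}^1\{\ell^n[f]\overline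 g-\ell^n[\overline g]f\}\,dx$; $\mathcal D^n_{\min}=\{f\in\mathcal D^n_{\max}:[f,g]_n|_{-1}^1=0\ \forall g\in\mathcal D^n_{\max}\}$; $\mathcal D^n_\pm=\{f\in\mathcal D^n_{\max}:\ell^n[f]=\pm if\}$.
   Formalization: The clause "so that these functions define a basis (modulo D_min^n) of D_+^n ∔ D_-^n" is dropped: that space has dimension 4n, so 2n functions cannot span it (e.g. n=1, P_0, Q_1); full rank of M_n alone is assumed, and the parity conclusion is unchanged. *)

theory Defs
  imports "HOL-Analysis.Set_Integral" "HOL-Analysis.Lebesgue_Measure" "HOL-Analysis.Derivative"
    "HOL-Computational_Algebra.Polynomial" "Jordan_Normal_Form.DL_Rank"
begin

fun legendre_P :: "nat \<Rightarrow> real poly" where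
  "legendre_P 0 = 1"
| "legendre_P (Suc 0) = [:0, 1:]"
| "legendre_P (Suc (Suc k)) =
     Polynomial.smult (1 / real (k + 2))
       (Polynomial.smult (real (2 * k + 3)) ([:0, 1:] * legendre_P (Suc k))
        - Polynomial.smult (real (k + 1)) (legendre_P k))"

text \<open>Only the values at points of the open interval \<open>(-1, 1)\<close> are meaningful.\<close>

fun legendre_Q :: "nat \<Rightarrow> real \<Rightarrow> real" where
  "legendre_Q 0 x = (1 / 2) * ln ((1 + x) / (1 - x))"
| "legendre_Q (Suc 0) x = x * legendre_Q 0 x - 1"
| "legendre_Q (Suc (Suc k)) x =
     (real (2 * k + 3) * x * legendre_Q (Suc k) x - real (k + 1) * legendre_Q k x) / real (k + 2)"

text \<open>
  Functions on \<open>(-1, 1)\<close> are represented by total functions on the reals. Since the interval is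
  open, the values on it of the expression below depend only on the values of \<open>y\<close> there.
\<close>

definition legendre_expr :: "(real \<Rightarrow> complex) \<Rightarrow> real \<Rightarrow> complex" where
  "legendre_expr y x =
     - vector_derivative (\<lambda>t. of_real (1 - t\<^sup>2) * vector_derivative y (at t)) (at x)"

text \<open>
  The sesquilinear form \<open>[f, g]\<^sub>n\<close> between the endpoints \<open>-1\<close> and \<open>1\<close>. It is meaningful for \<open>f\<close>
  and \<open>g\<close> in the maximal domain of the \<open>n\<close>-th power of the expression, to which all Legendre
  functions of both kinds belong.
\<close>

definition legendre_form :: "nat \<Rightarrow> (real \<Rightarrow> complex) \<Rightarrow> (real \<Rightarrow> complex) \<Rightarrow> complex" where
  "legendre_form n f g =
     (LINT x:{-1<..<1}|lebesgue.
        (legendre_expr ^^ n) f x * cnj (g x) - (legendre_expr ^^ n) (\<lambda>t. cnj (g t)) x * f x)"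

definition legendre_functions :: "nat list \<Rightarrow> nat list \<Rightarrow> (real \<Rightarrow> complex) list" where
  "legendre_functions js ks =
     map (\<lambda>j x. of_real (poly (legendre_P j) x)) js @ map (\<lambda>k x. of_real (legendre_Q k x)) ks"

definition form_matrix :: "nat \<Rightarrow> (real \<Rightarrow> complex) list \<Rightarrow> complex Matrix.mat" where
  "form_matrix n ws =
     Matrix.mat (length ws) (length ws) (\<lambda>(i, l). legendre_form n (ws ! i) (ws ! l))"

end

theory Submission
  imports Defs "HOL-Analysis.Equivalence_Lebesgue_Henstock_Integration"
begin

text \<open>
  Order the functions as \<open>P\<close>'s followed by \<open>Q\<close>'s. Two families of entries of the matrix vanish.
  The entry of two Legendre polynomials is zero, because on polynomials the expression is symmetric:
  the boundary terms of the partial integrations carry the factor \<open>1 - x\<^sup>2\<close>. An entry of two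
  functions of opposite parity is zero, because the expression preserves parity and so the integrand
  is odd. Here \<open>P\<^sub>k\<close> has the parity of \<open>k\<close> and \<open>Q\<^sub>k\<close> the opposite one; thus the entry of \<open>P\<^sub>j\<close>
  and \<open>Q\<^sub>k\<close> vanishes unless \<open>j\<close> and \<open>k\<close> have different parities.

  Full rank means that the determinant is non-zero, so some permutation \<open>\<pi>\<close> of the \<open>2n\<close> indices
  picks out only non-zero entries. It has to send the \<open>n\<close> rows of the \<open>P\<close>'s to the \<open>n\<close> columns of
  the \<open>Q\<close>'s, bijectively, and it matches each \<open>j\<^sub>i\<close> with a \<open>k\<^sub>l\<close> of the other parity. Hence
  as many of the \<open>2n\<close> numbers are even as are odd.

  For both statements about entries, all functions in question are treated at once, as
  \<open>p Q\<^sub>0 + q\<close> with polynomials \<open>p\<close> and \<open>q\<close>. This class is mapped into itself by the Legendre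
  expression since \<open>Q\<^sub>0' = 1 / (1 - x\<^sup>2)\<close>, and in it parity is a property of the coefficients.
\<close>

section \<open>Parity of polynomials\<close>

text \<open>
  The sign \<open>s\<close> is \<open>1\<close> for even and \<open>- 1\<close> for odd polynomials. Reflection is expressed as a
  composition so that derivatives can be treated by the chain rule.
\<close>

definition has_parity :: "real \<Rightarrow> real poly \<Rightarrow> bool" where
  "has_parity s p \<longleftrightarrow> pcompose p [:0, -1:] = Polynomial.smult s p"

lemma has_parity_poly: "has_parity s p \<Longrightarrow> poly p (- x) = s * poly p x"
  unfolding has_parity_def by (metis (no_types) poly_pcompose poly_smult poly_pCons poly_0
      add_0 mult_minus1_right mult_zero_right add.right_neutral)

lemma has_parity_0 [simp]: "has_parity s 0"
  by (simp add: has_parity_def)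

lemma has_parity_1 [simp]: "has_parity 1 1"
  by (simp add: has_parity_def pcompose_1)

lemma has_parity_X [simp]: "has_parity (- 1) [:0, 1:]"
  by (simp add: has_parity_def pcompose_pCons)

lemma has_parity_one_minus_square [simp]: "has_parity 1 [:1, 0, - 1:]"
  by (simp add: has_parity_def pcompose_pCons)

lemma has_parity_add: "has_parity s p \<Longrightarrow> has_parity s q \<Longrightarrow> has_parity s (p + q)"
  by (simp add: has_parity_def pcompose_add smult_add_right)

lemma has_parity_smult: "has_parity s p \<Longrightarrow> has_parity s (Polynomial.smult c p)"
  by (simp add: has_parity_def pcompose_smult mult.commute)

lemma has_parity_minus: "has_parity s p \<Longrightarrow> has_parity s (- p)"
  by (simp add: has_parity_def pcompose_uminus)

lemma has_parity_diff: "has_parity s p \<Longrightarrow> has_parity s q \<Longrightarrow> has_parity s (p - q)"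
  using has_parity_add[of s p "- q"] has_parity_minus[of s q] by simp

lemma has_parity_mult: "has_parity s p \<Longrightarrow> has_parity t q \<Longrightarrow> has_parity (s * t) (p * q)"
  by (simp add: has_parity_def pcompose_mult mult.commute)

lemma has_parity_pderiv:
  assumes "has_parity s p"
  shows "has_parity (- s) (pderiv p)"
proof -
  have "pderiv (pcompose p [:0, -1:]) = - pcompose (pderiv p) [:0, -1:]"
    by (simp add: pderiv_pcompose pderiv_pCons)
  then have "- pcompose (pderiv p) [:0, -1:] = Polynomial.smult s (pderiv p)"
    using assms by (simp add: has_parity_def pderiv_smult)
  then show ?thesis
    unfolding has_parity_def by (metis minus_minus smult_minus_left)
qed

section \<open>The Legendre expression on polynomials\<close>

definition legendre_op :: "real poly \<Rightarrow> real poly" where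
  "legendre_op p = - pderiv ([:1, 0, - 1:] * pderiv p)"

lemma legendre_op_0 [simp]: "legendre_op 0 = 0"
  by (simp add: legendre_op_def)

lemma has_parity_legendre_op:
  assumes "has_parity s p"
  shows "has_parity s (legendre_op p)"
proof -
  have "has_parity (- s) ([:1, 0, - 1:] * pderiv p)"
    using has_parity_mult[OF has_parity_one_minus_square has_parity_pderiv[OF assms]] by simp
  from has_parity_pderiv[OF this] show ?thesis
    unfolding legendre_op_def by (intro has_parity_minus) simp
qed

text \<open>
  Lagrange's identity for the \<open>n\<close>-th power. Moving one factor of the operator from \<open>p\<close> to \<open>q\<close>
  costs the derivative of a polynomial that vanishes at both end points.
\<close>

lemma legendre_op_power_lagrange:
  "\<exists>r. (legendre_op ^^ n) p * q - (legendre_op ^^ n) q * p = pderiv ([:1, 0, - 1:] * r)"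
proof (induction n arbitrary: q)
  case 0
  have "(legendre_op ^^ 0) p * q - (legendre_op ^^ 0) q * p = pderiv ([:1, 0, - 1:] * 0)"
    by (simp add: mult.commute)
  then show ?case
    by blast
next
  case (Suc n)
  define u where "u = (legendre_op ^^ n) p"
  define w where "w = [:1, 0, - 1 :: real:]"
  obtain r where r: "u * legendre_op q - (legendre_op ^^ n) (legendre_op q) * p
      = pderiv (w * r)"
    unfolding u_def w_def using Suc.IH by blast
  have "legendre_op u * q - u * legendre_op q
      = pderiv (w * (u * pderiv q - pderiv u * q))"
    unfolding legendre_op_def w_def[symmetric]
    by (simp add: pderiv_mult pderiv_diff algebra_simps)
  with r have "legendre_op u * q - (legendre_op ^^ n) (legendre_op q) * p
      = pderiv (w * r) + pderiv (w * (u * pderiv q - pderiv u * q))"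
    by (simp add: diff_eq_eq)
  also have "\<dots> = pderiv (w * (r + (u * pderiv q - pderiv u * q)))"
    by (simp only: pderiv_add[symmetric] distrib_left)
  finally have "(legendre_op ^^ Suc n) p * q - (legendre_op ^^ Suc n) q * p
      = pderiv (w * (r + (u * pderiv q - pderiv u * q)))"
    by (simp add: u_def funpow_swap1)
  then show ?case
    unfolding w_def by blast
qed

lemma set_integral_pderiv_eq_0:
  "(LINT x:{-1<..<1}|lebesgue. complex_of_real (poly (pderiv ([:1, 0, - 1:] * r)) x)) = 0"
proof -
  let ?p = "[:1, 0, - 1:] * r"
  have "(\<lambda>x. poly (pderiv ?p) x) absolutely_integrable_on {-1<..<1}"
    by (rule set_integrable_subset[OF absolutely_integrable_continuous_real[of "-1" 1]])
      (auto intro!: continuous_intros)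
  then have "(LINT x:{-1<..<1}|lebesgue. poly (pderiv ?p) x)
      = integral {-1..1} (\<lambda>x. poly (pderiv ?p) x)"
    by (simp add: set_lebesgue_integral_eq_integral integral_open_interval_real)
  also have "\<dots> = poly ?p 1 - poly ?p (- 1)"
    by (intro integral_unique fundamental_theorem_of_calculus)
      (simp, metis DERIV_subset[OF poly_DERIV] subset_UNIV
        has_real_derivative_iff_has_vector_derivative)
  also have "\<dots> = 0"
    by simp
  finally show ?thesis
    by (simp add: set_integral_complex_of_real)
qed

section \<open>Functions with a logarithmic part\<close>

definition log_poly :: "real poly \<Rightarrow> real poly \<Rightarrow> real \<Rightarrow> real" where
  "log_poly p q x = poly p x * legendre_Q 0 x + poly q x"

lemma legendre_Q_0_minus:
  assumes "x \<in> {-1<..<1}"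
  shows "legendre_Q 0 (- x) = - legendre_Q 0 x"
  using assms by (simp add: ln_div field_simps)

lemma log_poly_minus:
  assumes "has_parity (- s) p" "has_parity s q" "x \<in> {-1<..<1}"
  shows "log_poly p q (- x) = s * log_poly p q x"
  using assms(1,2)
  by (simp add: log_poly_def has_parity_poly legendre_Q_0_minus[OF assms(3)] algebra_simps
      del: legendre_Q.simps)

lemma legendre_Q_0_has_derivative:
  assumes "x \<in> {-1<..<1}"
  shows "(legendre_Q 0 has_real_derivative 1 / (1 - x\<^sup>2)) (at x)"
proof (rule has_field_derivative_transform_within_open[where S = "{-1<..<1}"])
  have nz: "1 + x \<noteq> 0" "1 - x \<noteq> 0"
    using assms by auto
  have "((\<lambda>x. (1 / 2) * (ln (1 + x) - ln (1 - x))) has_real_derivative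
      (1 / 2) * (1 / (1 + x) + 1 / (1 - x))) (at x)"
    using assms by (auto intro!: derivative_eq_intros)
  also have "(1 / 2) * (1 / (1 + x) + 1 / (1 - x)) = 1 / ((1 + x) * (1 - x))"
    using nz by (simp add: field_simps)
  also have "(1 + x) * (1 - x) = 1 - x\<^sup>2"
    by (simp add: power2_eq_square algebra_simps)
  finally show "((\<lambda>x. (1 / 2) * (ln (1 + x) - ln (1 - x))) has_real_derivative 1 / (1 - x\<^sup>2)) (at x)" .
qed (use assms in \<open>auto simp: ln_div\<close>)

lemma borel_measurable_log_poly [measurable]: "log_poly p q \<in> borel_measurable borel"
proof -
  have [measurable]: "poly r \<in> borel_measurable borel" for r :: "real poly"
    by (intro borel_measurable_continuous_onI continuous_intros)
  show ?thesis
    unfolding log_poly_def[abs_def] by simp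
qed

lemma vector_derivative_of_real_on_open:
  fixes f :: "real \<Rightarrow> complex"
  assumes "open S" "x \<in> S" "\<And>t. t \<in> S \<Longrightarrow> f t = of_real (g t)"
    and "(g has_real_derivative d) (at x)"
  shows "vector_derivative f (at x) = of_real d"
proof -
  have "((\<lambda>t. complex_of_real (g t)) has_vector_derivative of_real d) (at x)"
    using assms(4) by (intro has_vector_derivative_of_real)
      (simp add: has_real_derivative_iff_has_vector_derivative)
  then have "(f has_vector_derivative of_real d) (at x)"
    by (rule has_vector_derivative_transform_within_open[OF _ assms(1,2)]) (simp add: assms(3))
  then show ?thesis
    by (rule vector_derivative_at)
qed

text \<open>
  The factor \<open>1 - x\<^sup>2\<close> cancels the denominator of \<open>Q\<^sub>0'\<close>, and the logarithm is only multiplied by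
  polynomials.
\<close>

lemma legendre_expr_log_poly:
  assumes f: "\<And>x. x \<in> {-1<..<1} \<Longrightarrow> f x = of_real (log_poly p q x)"
    and x: "x \<in> {-1<..<1}"
  shows "legendre_expr f x
    = of_real (log_poly (legendre_op p) (legendre_op q - Polynomial.smult 2 (pderiv p)) x)"
proof -
  let ?w = "[:1, 0, - 1:] :: real poly"
  have deriv: "(log_poly a b has_real_derivative
      log_poly (pderiv a) (pderiv b) t + poly a t / (1 - t\<^sup>2)) (at t)"
    if "t \<in> {-1<..<1}" for a b t
    unfolding log_poly_def
    by (rule derivative_eq_intros poly_DERIV legendre_Q_0_has_derivative[OF that] refl)+
      (simp del: legendre_Q.simps)
  have w: "poly ?w t = 1 - t\<^sup>2" for t
    by (simp add: power2_eq_square)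
  have inner: "of_real (1 - t\<^sup>2) * vector_derivative f (at t)
      = of_real (log_poly (?w * pderiv p) (p + ?w * pderiv q) t)" if t: "t \<in> {-1<..<1}" for t
  proof -
    have "t\<^sup>2 < 1"
      using t by (simp add: abs_square_less_1 abs_less_iff)
    then have "(1 - t\<^sup>2) * (log_poly (pderiv p) (pderiv q) t + poly p t / (1 - t\<^sup>2))
        = log_poly (?w * pderiv p) (p + ?w * pderiv q) t"
      unfolding log_poly_def poly_add poly_mult w by (simp add: distrib_left del: legendre_Q.simps)
    moreover have "vector_derivative f (at t)
        = of_real (log_poly (pderiv p) (pderiv q) t + poly p t / (1 - t\<^sup>2))"
      by (rule vector_derivative_of_real_on_open[OF open_greaterThanLessThan t f deriv[OF t]])
    ultimately show ?thesis
      by (simp only: of_real_mult[symmetric])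
  qed
  have x2: "x\<^sup>2 < 1"
    using x by (simp add: abs_square_less_1 abs_less_iff)
  have "legendre_expr f x = - of_real (log_poly (pderiv (?w * pderiv p))
      (pderiv (p + ?w * pderiv q)) x + poly (?w * pderiv p) x / (1 - x\<^sup>2))"
    unfolding legendre_expr_def
    by (rule arg_cong[where f = uminus])
      (rule vector_derivative_of_real_on_open[OF open_greaterThanLessThan x inner deriv[OF x]])
  also have "poly (?w * pderiv p) x / (1 - x\<^sup>2) = poly (pderiv p) x"
    unfolding poly_mult w using x2 by simp
  also have "- complex_of_real (log_poly (pderiv (?w * pderiv p)) (pderiv (p + ?w * pderiv q)) x
      + poly (pderiv p) x)
      = of_real (log_poly (legendre_op p) (legendre_op q - Polynomial.smult 2 (pderiv p)) x)"
    unfolding legendre_op_def log_poly_def of_real_minus[symmetric]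
    by (simp add: pderiv_add del: legendre_Q.simps mult_pCons_left)
  finally show ?thesis .
qed

text \<open>
  Without a logarithmic part the correction term in the previous formula is absent at every step.
\<close>

lemma legendre_expr_power_poly:
  assumes "\<And>x. x \<in> {-1<..<1} \<Longrightarrow> f x = of_real (poly q x)" and "x \<in> {-1<..<1}"
  shows "(legendre_expr ^^ n) f x = of_real (poly ((legendre_op ^^ n) q) x)"
  using assms(2)
proof (induction n arbitrary: x)
  case 0
  then show ?case
    using assms(1) by simp
next
  case (Suc n)
  show ?case
    using legendre_expr_log_poly[of "(legendre_expr ^^ n) f" 0 "(legendre_op ^^ n) q" x]
      Suc by (simp add: log_poly_def)
qed

section \<open>Vanishing entries\<close>

text \<open>
  The logarithm \<open>Q\<^sub>0\<close> is odd, so its coefficient must have the sign opposite to that of the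
  function. Only the values on the open interval are prescribed, as they are all that the form sees.
\<close>

definition parity_log_poly :: "real \<Rightarrow> (real \<Rightarrow> complex) \<Rightarrow> bool" where
  "parity_log_poly s f \<longleftrightarrow> (\<exists>p q. has_parity (- s) p \<and> has_parity s q
     \<and> (\<forall>x \<in> {-1<..<1}. f x = of_real (log_poly p q x)))"

lemma parity_log_poly_legendre_expr:
  assumes "parity_log_poly s f"
  shows "parity_log_poly s (legendre_expr f)"
proof -
  obtain p q where p: "has_parity (- s) p" and q: "has_parity s q"
    and f: "\<And>x. x \<in> {-1<..<1} \<Longrightarrow> f x = of_real (log_poly p q x)"
    using assms unfolding parity_log_poly_def by blast
  have "has_parity s (legendre_op q - Polynomial.smult 2 (pderiv p))"
    using has_parity_pderiv[OF p] has_parity_legendre_op[OF q]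
    by (intro has_parity_diff has_parity_smult) simp_all
  then show ?thesis
    unfolding parity_log_poly_def
    using has_parity_legendre_op[OF p] legendre_expr_log_poly[OF f] by blast
qed

lemma parity_log_poly_legendre_expr_power:
  "parity_log_poly s f \<Longrightarrow> parity_log_poly s ((legendre_expr ^^ n) f)"
  by (induction n) (simp_all add: parity_log_poly_legendre_expr)

lemma parity_log_poly_cnj: "parity_log_poly s f \<Longrightarrow> parity_log_poly s (\<lambda>x. cnj (f x))"
  unfolding parity_log_poly_def by (metis complex_cnj_complex_of_real)

text \<open>
  The substitution \<open>x \<mapsto> - x\<close> holds for the Bochner integral of every function, so the integrals of
  products of functions with logarithmic singularities need no estimates.
\<close>

lemma set_integral_odd_eq_0:
  fixes h :: "real \<Rightarrow> real"
  assumes [measurable]: "h \<in> borel_measurable borel"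
    and odd: "\<And>x. x \<in> {-1<..<1} \<Longrightarrow> h (- x) = - h x"
  shows "(LINT x:{-1<..<1}|lebesgue. h x) = 0"
proof -
  let ?g = "\<lambda>x. indicator {-1<..<1} x *\<^sub>R h x"
  have "(\<integral>x. ?g x \<partial>lborel) = (\<integral>x. ?g (- x) \<partial>lborel)"
    using lborel_integral_real_affine[of "-1" ?g 0] by simp
  also have "\<dots> = (\<integral>x. - ?g x \<partial>lborel)"
    by (rule Bochner_Integration.integral_cong) (auto simp: odd indicator_def)
  finally have "(\<integral>x. ?g x \<partial>lborel) = 0"
    by simp
  then show ?thesis
    unfolding set_lebesgue_integral_def by (subst integral_completion) simp_all
qed

text \<open>
  Powers of the expression and conjugation leave the parities of \<open>f\<close> and \<open>g\<close> unchanged, so each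
  of the two products in the integrand is odd.
\<close>

lemma legendre_form_opposite_parity:
  assumes "parity_log_poly s f" "parity_log_poly (- s) g" and s: "s * s = 1"
  shows "legendre_form n f g = 0"
proof -
  obtain p q where pq: "has_parity (- s) p" "has_parity s q"
    and f: "\<And>x. x \<in> {-1<..<1} \<Longrightarrow> f x = of_real (log_poly p q x)"
    using assms(1) unfolding parity_log_poly_def by blast
  obtain p' q' where pq': "has_parity (- s) p'" "has_parity s q'"
    and f': "\<And>x. x \<in> {-1<..<1} \<Longrightarrow> (legendre_expr ^^ n) f x = of_real (log_poly p' q' x)"
    using parity_log_poly_legendre_expr_power[OF assms(1), of n]
    unfolding parity_log_poly_def by blast
  obtain u v where uv: "has_parity (- (- s)) u" "has_parity (- s) v"
    and g: "\<And>x. x \<in> {-1<..<1} \<Longrightarrow> cnj (g x) = of_real (log_poly u v x)"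
    using parity_log_poly_cnj[OF assms(2)] unfolding parity_log_poly_def by blast
  obtain u' v' where uv': "has_parity (- (- s)) u'" "has_parity (- s) v'"
    and g': "\<And>x. x \<in> {-1<..<1} \<Longrightarrow>
      (legendre_expr ^^ n) (\<lambda>t. cnj (g t)) x = of_real (log_poly u' v' x)"
    using parity_log_poly_legendre_expr_power[OF parity_log_poly_cnj[OF assms(2)], of n]
    unfolding parity_log_poly_def by blast
  define h where "h x = log_poly p' q' x * log_poly u v x - log_poly u' v' x * log_poly p q x"
    for x
  have "legendre_form n f g = (LINT x:{-1<..<1}|lebesgue. complex_of_real (h x))"
    unfolding legendre_form_def
    by (rule set_lebesgue_integral_cong) (auto simp: f f' g g' h_def)
  also have "\<dots> = of_real (LINT x:{-1<..<1}|lebesgue. h x)"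
    by (rule set_integral_complex_of_real)
  also have "(LINT x:{-1<..<1}|lebesgue. h x) = 0"
  proof (rule set_integral_odd_eq_0)
    show "h \<in> borel_measurable borel"
      unfolding h_def[abs_def] by measurable
  next
    fix x :: real
    assume x: "x \<in> {-1<..<1}"
    have "h (- x) = - (s * s) * h x"
      unfolding h_def log_poly_minus[OF pq x] log_poly_minus[OF pq' x]
        log_poly_minus[OF uv x] log_poly_minus[OF uv' x]
      by (simp add: algebra_simps)
    then show "h (- x) = - h x"
      by (simp add: s)
  qed
  finally show ?thesis
    by simp
qed

text \<open>
  By Lagrange's identity the integrand is the derivative of a polynomial that is zero at \<open>-1\<close>
  and at \<open>1\<close>.
\<close>

lemma legendre_form_poly:
  "legendre_form n (\<lambda>x. of_real (poly p x)) (\<lambda>x. of_real (poly q x)) = 0"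
proof -
  obtain r where
    r: "(legendre_op ^^ n) p * q - (legendre_op ^^ n) q * p = pderiv ([:1, 0, - 1:] * r)"
    using legendre_op_power_lagrange by blast
  have "legendre_form n (\<lambda>x. of_real (poly p x)) (\<lambda>x. of_real (poly q x))
      = (LINT x:{-1<..<1}|lebesgue. complex_of_real (poly (pderiv ([:1, 0, - 1:] * r)) x))"
    unfolding legendre_form_def
    by (rule set_lebesgue_integral_cong)
      (auto simp: legendre_expr_power_poly simp flip: r simp del: mult_pCons_left)
  then show ?thesis
    by (simp only: set_integral_pderiv_eq_0)
qed

section \<open>Parity of the Legendre functions\<close>

lemma has_parity_legendre_P: "has_parity ((- 1) ^ k) (legendre_P k)"
proof (induction k rule: legendre_P.induct)
  case (3 k)
  have "has_parity ((- 1) ^ Suc (Suc k)) ([:0, 1:] * legendre_P (Suc k))"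
    using has_parity_mult[OF has_parity_X 3(1)] by simp
  with 3(2) show ?case
    unfolding legendre_P.simps(3)
    by (intro has_parity_smult has_parity_diff) (simp_all del: mult_pCons_left)
qed simp_all

text \<open>
  The recurrence is the same for both kinds; \<open>p\<close> is in fact \<open>P\<^sub>k\<close>, and \<open>q\<close> is the polynomial
  part, which starts with \<open>0\<close> and \<open>- 1\<close>.
\<close>

lemma legendre_Q_eq_log_poly:
  "\<exists>p q. has_parity ((- 1) ^ k) p \<and> has_parity (- ((- 1) ^ k)) q \<and> legendre_Q k = log_poly p q"
proof (induction k rule: legendre_P.induct)
  case 1
  have "legendre_Q 0 = log_poly 1 0"
    by (rule ext) (simp add: log_poly_def)
  then show ?case
    by (intro exI[of _ 1] exI[of _ 0]) simp
next
  case 2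
  have "legendre_Q (Suc 0) = log_poly [:0, 1:] (- 1)"
    by (rule ext) (simp add: log_poly_def)
  then show ?case
    by (intro exI[of _ "[:0, 1:]"] exI[of _ "- 1"]) (simp add: has_parity_minus)
next
  case (3 k)
  obtain p q u v where p: "has_parity ((- 1) ^ k) p" and q: "has_parity (- ((- 1) ^ k)) q"
    and k: "legendre_Q k = log_poly p q"
    and u: "has_parity ((- 1) ^ Suc k) u" and v: "has_parity (- ((- 1) ^ Suc k)) v"
    and Suc_k: "legendre_Q (Suc k) = log_poly u v"
    using 3 by blast
  define step where "step a b = Polynomial.smult (1 / real (k + 2))
     (Polynomial.smult (real (2 * k + 3)) ([:0, 1:] * a) - Polynomial.smult (real (k + 1)) b)"
    for a b
  have "legendre_Q (Suc (Suc k)) = log_poly (step u p) (step v q)"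
    unfolding legendre_Q.simps(3) k Suc_k
    by (rule ext, unfold log_poly_def step_def poly_smult poly_diff poly_mult divide_inverse)
      (simp add: algebra_simps del: legendre_Q.simps of_nat_add of_nat_mult of_nat_Suc)
  moreover have "has_parity ((- 1) ^ Suc (Suc k)) (step u p)"
    using has_parity_mult[OF has_parity_X u] p
    unfolding step_def by (intro has_parity_smult has_parity_diff) (simp_all del: mult_pCons_left)
  moreover have "has_parity (- ((- 1) ^ Suc (Suc k))) (step v q)"
    using has_parity_mult[OF has_parity_X v] q
    unfolding step_def by (intro has_parity_smult has_parity_diff) (simp_all del: mult_pCons_left)
  ultimately show ?case
    by blast
qed

lemma parity_log_poly_legendre_P:
  "parity_log_poly ((- 1) ^ k) (\<lambda>x. of_real (poly (legendre_P k) x))"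
  unfolding parity_log_poly_def using has_parity_legendre_P[of k]
  by (intro exI[of _ 0] exI[of _ "legendre_P k"]) (simp add: log_poly_def)

lemma parity_log_poly_legendre_Q:
  "parity_log_poly (- ((- 1) ^ k)) (\<lambda>x. of_real (legendre_Q k x))"
  unfolding parity_log_poly_def minus_minus using legendre_Q_eq_log_poly[of k]
  by (elim exE conjE) (simp, blast)

lemma legendre_form_P_Q:
  assumes "even j \<longleftrightarrow> even k"
  shows "legendre_form n (\<lambda>x. of_real (poly (legendre_P j) x)) (\<lambda>x. of_real (legendre_Q k x)) = 0"
proof (rule legendre_form_opposite_parity[OF parity_log_poly_legendre_P])
  have "((- 1) ^ j :: real) = (- 1) ^ k"
    using assms by (simp add: minus_one_power_iff)
  then show "parity_log_poly (- ((- 1) ^ j)) (\<lambda>x. of_real (legendre_Q k x))"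
    using parity_log_poly_legendre_Q[of k] by simp
qed (simp flip: power_mult_distrib)

section \<open>Counting parities\<close>

text \<open>Some summand in the Leibniz formula is non-zero.\<close>

lemma det_nonzero_permutation:
  fixes A :: "'a :: idom Matrix.mat"
  assumes "A \<in> carrier_mat m m" "Determinant.det A \<noteq> 0"
  obtains \<pi> where "\<pi> permutes {0..<m}" "\<And>i. i < m \<Longrightarrow> A $$ (i, \<pi> i) \<noteq> 0"
proof -
  obtain \<pi> where \<pi>: "\<pi> permutes {0..<m}"
    and "signof \<pi> * (\<Prod>i = 0..<m. A $$ (i, \<pi> i)) \<noteq> 0"
    using assms(2) unfolding det_def'[OF assms(1)] by (auto elim: sum.not_neutral_contains_not_neutral)
  then show thesis
    by (intro that[OF \<pi>]) auto
qed

lemma size_filter_mset_eq_card: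
  "size (filter_mset R (mset xs)) = card {i. i < length xs \<and> R (xs ! i)}"
  by (metis length_filter_conv_card mset_filter size_mset)

theorem proposition4p3:
  fixes n :: nat and js ks :: "nat list"
  assumes "n \<ge> 1"
    and "length js = n" and "length ks = n"
    and "vec_space.rank (2 * n) (form_matrix n (legendre_functions js ks)) = 2 * n"
  shows "size (filter_mset even (mset js + mset ks)) = n
       \<and> size (filter_mset odd (mset js + mset ks)) = n"
proof -
  define ws where "ws = legendre_functions js ks"
  define M where "M = form_matrix n ws"
  have len: "length ws = 2 * n"
    by (simp add: ws_def legendre_functions_def assms(2,3))
  have ws_P: "ws ! i = (\<lambda>x. of_real (poly (legendre_P (js ! i)) x))" if "i < n" for i
    using that by (simp add: ws_def legendre_functions_def nth_append assms(2))
  have ws_Q: "ws ! (n + l) = (\<lambda>x. of_real (legendre_Q (ks ! l) x))" if "l < n" for l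
    using that by (simp add: ws_def legendre_functions_def nth_append assms(2,3))
  have M: "M \<in> carrier_mat (2 * n) (2 * n)"
    by (simp add: M_def form_matrix_def len)
  have "Determinant.det M \<noteq> 0"
    using vec_space.det_rank_iff[OF M] assms(4) by (simp add: M_def ws_def)
  then obtain \<pi> where \<pi>: "\<pi> permutes {0..<2 * n}"
    and nz: "\<And>i. i < 2 * n \<Longrightarrow> M $$ (i, \<pi> i) \<noteq> 0"
    using det_nonzero_permutation[OF M] by blast
  have bound: "\<pi> i < 2 * n" if "i < 2 * n" for i
    using permutes_in_image[OF \<pi>, of i] that by simp
  have entry: "legendre_form n (ws ! i) (ws ! \<pi> i) \<noteq> 0" if "i < 2 * n" for i
    using nz[OF that] bound[OF that] that by (simp add: M_def form_matrix_def len)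
  \<comment> \<open>The block of pairs of Legendre polynomials is zero.\<close>
  have P_to_Q: "n \<le> \<pi> i" if "i < n" for i
  proof (rule ccontr)
    assume "\<not> n \<le> \<pi> i"
    then show False
      using entry[of i] that by (simp add: ws_P legendre_form_poly)
  qed
  \<comment> \<open>\<open>\<sigma>\<close> is the resulting matching of the list \<open>js\<close> with the list \<open>ks\<close>.\<close>
  define \<sigma> where "\<sigma> i = \<pi> i - n" for i
  have \<sigma>_less: "\<sigma> i < n" and \<pi>_eq: "\<pi> i = n + \<sigma> i" if "i < n" for i
    using P_to_Q[OF that] bound[of i] that by (simp_all add: \<sigma>_def)
  have inj: "inj_on \<sigma> {..<n}"
    using permutes_inj[OF \<pi>] by (metis (no_types, lifting) inj_onI injD lessThan_iff \<pi>_eq)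
  then have image: "\<sigma> ` {..<n} = {..<n}"
    using \<sigma>_less by (intro endo_inj_surj) auto
  have parity: "even (ks ! \<sigma> i) \<longleftrightarrow> odd (js ! i)" if "i < n" for i
    using entry[of i] that legendre_form_P_Q[of "js ! i" "ks ! \<sigma> i" n]
    by (auto simp: ws_P ws_Q \<pi>_eq \<sigma>_less)
  have match: "card {l. l < n \<and> R (ks ! l)} = card {i. i < n \<and> R (ks ! \<sigma> i)}" for R
  proof -
    have "{l. l < n \<and> R (ks ! l)} = \<sigma> ` {i. i < n \<and> R (ks ! \<sigma> i)}"
    proof (intro equalityI subsetI)
      fix l assume "l \<in> {l. l < n \<and> R (ks ! l)}"
      moreover from this have "l \<in> \<sigma> ` {..<n}"
        by (simp add: image)
      ultimately show "l \<in> \<sigma> ` {i. i < n \<and> R (ks ! \<sigma> i)}"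
        by auto
    qed (auto simp: \<sigma>_less)
    moreover have "inj_on \<sigma> {i. i < n \<and> R (ks ! \<sigma> i)}"
      by (rule inj_on_subset[OF inj]) auto
    ultimately show ?thesis
      by (simp add: card_image)
  qed
  have even_ks: "card {l. l < n \<and> even (ks ! l)} = card {i. i < n \<and> odd (js ! i)}"
    using match[of even] parity by (simp cong: conj_cong)
  have odd_ks: "card {l. l < n \<and> odd (ks ! l)} = card {i. i < n \<and> even (js ! i)}"
    using match[of odd] parity by (simp cong: conj_cong)
  have "card {i. i < n \<and> even (js ! i)} + card {i. i < n \<and> odd (js ! i)}
      = card ({i. i < n \<and> even (js ! i)} \<union> {i. i < n \<and> odd (js ! i)})"
    by (rule card_Un_disjoint[symmetric]) auto
  also have "{i. i < n \<and> even (js ! i)} \<union> {i. i < n \<and> odd (js ! i)} = {..<n}"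
    by auto
  finally show ?thesis
    by (simp add: size_filter_mset_eq_card assms(2,3) even_ks odd_ks)
qed

end
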